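(* Let $A,B\in\mathbb{Q}$ with $AB\neq 0$. The trinomial $x^4+Ax^2+B$ has reducibility type $(1,1,2)$ if and only if, up to scaling, $(A,B)=(q-1,-q)$ for some $q\in\mathbb{Q}\setminus\{1\}$ such that $-q$ is not the square of a rational number, with factorization $$x^4+Ax^2+B=(x-1)(x+1)(x^2+q);$$ and it has reducibility type $(1,1,1,1)$ if and only if, up to scaling, $(A,B)=(-u^2-1,u^2)$ for some $u\in\mathbb{Q}\setminus\{0\}$, with factorization $$x^4+Ax^2+B=(x-1)(x+1)(x-u)(x+u).$$
   Context: A monic polynomial in $\mathbb{Q}[x]$ has reducibility type $(n_1,\dots,n_k)$, $n_1\le\dots\le n_k$, if it factors as a product of $k$ irreducible polynomials in $\mathbb{Q}[x]$ (not necessarily distinct) of degrees $n_1,\dots,n_k$. Trinomials are considered up to scaling: $x^n+Ax^m+B$ and $x^n+A\lambda^{n-m}x^m+B\lambda^n$ are identified for $\lambda\in\mathbb{Q}\setminus\{0\}$; "up to scaling $(A,B)=(A_0,B_0)$" means $(A,B)=(A_0\lambda^{n-m},B_0\lambda^n)$ for some $\lambda\in\mathbb{Q}\setminus\{0\}$ (and the factorization is that of the scaled trinomial). *)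

theory Defs
  imports Complex_Main "HOL-Computational_Algebra.Polynomial_Factorial"
begin

text \<open>The factors need be neither monic nor distinct. Over \<^typ>\<open>rat\<close> the units of the
  polynomial ring are the nonzero constants, so \<^const>\<open>irreducible\<close> is irreducibility
  in \<open>\<rat>[x]\<close> and irreducible factors have positive degree.\<close>

definition reducibility_type :: "rat poly \<Rightarrow> nat list \<Rightarrow> bool" where
  "reducibility_type p ns \<longleftrightarrow>
     lead_coeff p = 1 \<and> sorted ns \<and>
     (\<exists>fs. p = prod_list fs \<and> (\<forall>f\<in>set fs. irreducible f) \<and> map degree fs = ns)"

definition trinomial :: "nat \<Rightarrow> nat \<Rightarrow> rat \<Rightarrow> rat \<Rightarrow> rat poly" where
  "trinomial n m A B = monom 1 n + monom A m + monom B 0"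

text \<open>Intended for \<open>m < n\<close>, so the subtraction on \<^typ>\<open>nat\<close> is exact.\<close>

definition eq_up_to_scaling :: "nat \<Rightarrow> nat \<Rightarrow> rat \<times> rat \<Rightarrow> rat \<times> rat \<Rightarrow> bool" where
  "eq_up_to_scaling n m = (\<lambda>(A, B) (A0, B0).
     \<exists>l::rat. l \<noteq> 0 \<and> A = A0 * l ^ (n - m) \<and> B = B0 * l ^ n)"

end

theory Submission
  imports Defs
begin

text \<open>A rational root \<open>r\<close> of \<open>x\<^sup>4 + A x\<^sup>2 + B\<close> is nonzero, and then \<open>- r\<close> is a root as well,
  so the quartic is \<open>(x - r)(x + r)(x\<^sup>2 + c)\<close>. Scaling by \<open>r\<close> reduces to \<open>r = 1\<close>, and by unique
  factorization the type is decided by whether \<open>- c\<close> is a square.\<close>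

text \<open>Over a field an irreducible polynomial is prime, so \<open>g\<close> divides a single
  factor \<open>f\<close>, and irreducibility of \<open>f\<close> makes the two associated. This is
  the part of unique factorization needed to compare a known factorization with an arbitrary
  one.\<close>

lemma irreducible_prod_list_dvd_degree:
  fixes g :: "'a :: field poly"
  assumes "irreducible g" "g dvd prod_list fs" "\<forall>f\<in>set fs. irreducible f"
  shows "degree g \<in> set (map degree fs)"
proof -
  have g: "prime_elem g"
    using assms(1) by (rule field_poly_irreducible_imp_prime)
  obtain f where f: "f \<in> set fs" "g dvd f"
    using assms(2) g
  proof (induction fs)
    case Nil
    then show ?case using prime_elem_not_unit by auto
  next
    case (Cons a fs)
    then show ?case by (auto simp: prime_elem_dvd_mult_iff)
  qed
  then obtain k where k: "f = g * k" by (elim dvdE)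
  have "irreducible f" using assms(3) f by blast
  \<comment> \<open>Of the two factors \<open>g\<close> and \<open>k\<close> of \<open>f\<close>,
    only \<open>k\<close> can be the unit.\<close>
  then have "is_unit k" "f \<noteq> 0"
    using irreducibleD[OF _ k] assms(1) by (auto simp: irreducible_def)
  then have "degree f = degree g"
    using k by (auto simp: degree_mult_eq is_unit_iff_degree)
  then show ?thesis using f by (metis image_eqI set_map)
qed

lemma irreducible_linear:
  fixes a b :: "'a :: field"
  assumes "b \<noteq> 0"
  shows "irreducible [:a, b:]"
proof (rule irreducibleI)
  fix p q assume eq: "[:a, b:] = p * q"
  then have nz: "p \<noteq> 0" "q \<noteq> 0" using assms by auto
  then have "degree p + degree q = 1"
    using arg_cong[OF eq, of degree] assms by (simp add: degree_mult_eq)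
  then show "is_unit p \<or> is_unit q"
    using nz by (auto simp: is_unit_iff_degree)
qed (use assms in \<open>auto simp: is_unit_iff_degree\<close>)

lemma degree_1_root:
  fixes f :: "'a :: field poly"
  assumes "degree f = 1"
  obtains r where "poly f r = 0"
proof -
  obtain a b where "f = [:a, b:]" "b \<noteq> 0"
    using assms by (metis degree1_coeffs)
  then have "poly f (- a / b) = 0" by simp
  then show thesis by (rule that)
qed

text \<open>A proper factorization of a quadratic has two linear factors, hence a root, and the
  roots of x^2 + c are the square roots of \<open>- c\<close>.\<close>

lemma irreducible_quadratic_iff:
  fixes c :: "'a :: field"
  shows "irreducible [:c, 0, 1:] \<longleftrightarrow> (\<forall>r. - c \<noteq> r\<^sup>2)"
proof
  assume irr: "irreducible [:c, 0, 1:]"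
  show "\<forall>r. - c \<noteq> r\<^sup>2"
  proof (intro allI notI)
    fix r assume "- c = r\<^sup>2"
    then have "[:c, 0, 1:] = [:- r, 1:] * [:r, 1:]"
      by (simp add: power2_eq_square minus_equation_iff[of c])
    from irreducibleD[OF irr this] show False
      by (simp add: is_unit_iff_degree)
  qed
next
  assume no_root: "\<forall>r. - c \<noteq> r\<^sup>2"
  show "irreducible [:c, 0, 1:]"
  proof (rule irreducibleI)
    fix p q assume eq: "[:c, 0, 1:] = p * q"
    then have nz: "p \<noteq> 0" "q \<noteq> 0" by auto
    then have deg: "degree p + degree q = 2"
      using arg_cong[OF eq, of degree] by (simp add: degree_mult_eq)
    have root: "poly p r * poly q r \<noteq> 0" for r
    proof
      assume "poly p r * poly q r = 0"
      then have "poly [:c, 0, 1:] r = 0" by (simp only: eq poly_mult)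
      then have "- c = r\<^sup>2"
        by (simp add: power2_eq_square add_eq_0_iff)
      then show False using no_root by blast
    qed
    \<comment> \<open>A linear \<open>p\<close> would supply a root. The degrees of \<open>p\<close>
      and \<open>q\<close> are therefore 0 and 2 in some order, and one factor is a unit.\<close>
    have "degree p \<noteq> 1"
      using root by (metis degree_1_root mult_zero_left)
    then show "is_unit p \<or> is_unit q"
      using nz deg by (auto simp: is_unit_iff_degree)
  qed (auto simp: is_unit_iff_degree)
qed

lemma trinomial_4_2: "trinomial 4 2 A B = [:B, 0, A, 0, 1:]"
  by (simp add: trinomial_def monom_altdef numeral_eq_Suc)

lemma biquadratic_factor:
  "[:- l, 1:] * [:l, 1:] * [:c, 0, 1:] = trinomial 4 2 (c - l\<^sup>2) (- c * l\<^sup>2)"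
  by (simp add: trinomial_4_2 power2_eq_square)

text \<open>A factor of degree 1 has a root \<open>r\<close>. Evaluating the quartic there gives B =
  -(A + r^2) r^2, so c = A + r^2 works, and \<open>r\<close> is nonzero because \<open>B\<close>
  is.\<close>

lemma reducibility_type_linear_factor:
  assumes "reducibility_type (trinomial 4 2 A B) ns" "1 \<in> set ns" "B \<noteq> 0"
  obtains r c where "r \<noteq> 0" "A = c - r\<^sup>2" "B = - c * r\<^sup>2"
proof -
  obtain fs where fs: "trinomial 4 2 A B = prod_list fs" "map degree fs = ns"
    using assms(1) by (auto simp: reducibility_type_def)
  then obtain f where f: "f \<in> set fs" "degree f = 1"
    using assms(2) by auto
  obtain r where "poly f r = 0" using f(2) by (rule degree_1_root)
  moreover have "f dvd trinomial 4 2 A B"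
    using f(1) fs(1) by (simp add: prod_list_dvd)
  ultimately have "poly (trinomial 4 2 A B) r = 0" by (auto elim!: dvdE)
  then have B: "B = - (A + r\<^sup>2) * r\<^sup>2"
    by (simp add: trinomial_4_2 power2_eq_square algebra_simps)
  show thesis
    by (rule that[of r "A + r\<^sup>2"]) (use B assms(3) in auto)
qed

text \<open>The quadratic factor is irreducible here, so its degree must occur in every
  factorization into irreducibles. Read contrapositively, a type without 2 forces \<open>- c\<close>
  to be a square.\<close>

lemma reducibility_type_quadratic_factor:
  assumes "reducibility_type (trinomial 4 2 (c - l\<^sup>2) (- c * l\<^sup>2)) ns" "\<forall>r. - c \<noteq> r\<^sup>2"
  shows "2 \<in> set ns"
proof -
  obtain fs where fs: "trinomial 4 2 (c - l\<^sup>2) (- c * l\<^sup>2) = prod_list fs"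
      "\<forall>f\<in>set fs. irreducible f" "map degree fs = ns"
    using assms(1) by (auto simp: reducibility_type_def)
  have "[:c, 0, 1:] dvd prod_list fs"
    unfolding fs(1)[symmetric] biquadratic_factor[symmetric] by (rule dvd_triv_right)
  from irreducible_prod_list_dvd_degree[OF _ this fs(2)] show ?thesis
    using assms(2) fs(3) by (simp add: irreducible_quadratic_iff numeral_2_eq_2)
qed

lemma reducibility_type_112I:
  assumes "\<forall>r. - c \<noteq> r\<^sup>2"
  shows "reducibility_type (trinomial 4 2 (c - l\<^sup>2) (- c * l\<^sup>2)) [1, 1, 2]"
  unfolding reducibility_type_def
proof (intro conjI exI)
  show "trinomial 4 2 (c - l\<^sup>2) (- c * l\<^sup>2) = prod_list [[:- l, 1:], [:l, 1:], [:c, 0, 1:]]"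
    by (simp only: biquadratic_factor[symmetric] prod_list.Cons prod_list.Nil mult_1_right mult.assoc)
qed (use assms in \<open>auto simp: trinomial_4_2 irreducible_linear irreducible_quadratic_iff\<close>)

text \<open>This is the case c = -t^2 of \<open>biquadratic_factor\<close>, where the quadratic
  splits too. Repeated factors, as for t = l, are compatible with the type.\<close>

lemma biquadratic_split:
  "[:- l, 1:] * [:l, 1:] * [:- t, 1:] * [:t, 1:] = trinomial 4 2 (- t\<^sup>2 - l\<^sup>2) (t\<^sup>2 * l\<^sup>2)"
  by (simp add: trinomial_4_2 power2_eq_square algebra_simps)

lemma reducibility_type_1111I:
  "reducibility_type (trinomial 4 2 (- t\<^sup>2 - l\<^sup>2) (t\<^sup>2 * l\<^sup>2)) [1, 1, 1, 1]"
  unfolding reducibility_type_def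
proof (intro conjI exI)
  show "trinomial 4 2 (- t\<^sup>2 - l\<^sup>2) (t\<^sup>2 * l\<^sup>2) =
      prod_list [[:- l, 1:], [:l, 1:], [:- t, 1:], [:t, 1:]]"
    by (simp only: biquadratic_split[symmetric] prod_list.Cons prod_list.Nil mult_1_right mult.assoc)
qed (auto simp: trinomial_4_2 irreducible_linear)

text \<open>Each irreducible factor divides a product of linear polynomials, so it is itself linear.
  This rules out type (1,1,2) when \<open>- c\<close> is a square.\<close>

lemma biquadratic_split_degrees:
  assumes "reducibility_type (trinomial 4 2 (- t\<^sup>2 - l\<^sup>2) (t\<^sup>2 * l\<^sup>2)) ns"
  shows "set ns \<subseteq> {1}"
proof -
  obtain fs where fs: "trinomial 4 2 (- t\<^sup>2 - l\<^sup>2) (t\<^sup>2 * l\<^sup>2) = prod_list fs"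
      "\<forall>f\<in>set fs. irreducible f" "map degree fs = ns"
    using assms by (auto simp: reducibility_type_def)
  have "degree f = 1" if f: "f \<in> set fs" for f
  proof -
    let ?gs = "[[:- l, 1:], [:l, 1:], [:- t, 1:], [:t, 1:]]"
    have "prod_list ?gs = prod_list fs"
      by (simp only: fs(1)[symmetric] biquadratic_split[symmetric]
          prod_list.Cons prod_list.Nil mult_1_right mult.assoc)
    then have "f dvd prod_list ?gs" using f by (metis prod_list_dvd)
    from irreducible_prod_list_dvd_degree[OF _ this] have "degree f \<in> set (map degree ?gs)"
      using f fs(2) by (simp add: irreducible_linear)
    then show ?thesis by simp
  qed
  then show ?thesis using fs(3) by auto
qed

theorem theorem2p2:
  fixes A B :: rat
  assumes "A * B \<noteq> 0"
  shows
    "(reducibility_type (trinomial 4 2 A B) [1, 1, 2] \<longleftrightarrow>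
        (\<exists>q::rat. q \<noteq> 1 \<and> \<not> (\<exists>r::rat. - q = r ^ 2) \<and>
           eq_up_to_scaling 4 2 (A, B) (q - 1, - q))) \<and>
     (\<forall>q::rat. q \<noteq> 1 \<and> \<not> (\<exists>r::rat. - q = r ^ 2) \<longrightarrow>
        trinomial 4 2 (q - 1) (- q) = [:- 1, 1:] * [:1, 1:] * [:q, 0, 1:]) \<and>
     (reducibility_type (trinomial 4 2 A B) [1, 1, 1, 1] \<longleftrightarrow>
        (\<exists>u::rat. u \<noteq> 0 \<and>
           eq_up_to_scaling 4 2 (A, B) (- (u ^ 2) - 1, u ^ 2))) \<and>
     (\<forall>u::rat. u \<noteq> 0 \<longrightarrow>
        trinomial 4 2 (- (u ^ 2) - 1) (u ^ 2) =
          [:- 1, 1:] * [:1, 1:] * [:- u, 1:] * [:u, 1:])"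
proof (intro conjI iffI allI impI)
  have AB: "A \<noteq> 0" "B \<noteq> 0" using assms by auto
  {
    assume red: "reducibility_type (trinomial 4 2 A B) [1, 1, 2]"
    obtain r c where rc: "r \<noteq> 0" "A = c - r\<^sup>2" "B = - c * r\<^sup>2"
      using reducibility_type_linear_factor[OF red _ AB(2)] by auto
    \<comment> \<open>Scaling by \<open>r\<close> moves the roots r and -r to 1 and -1 and turns x^2
      + c into x^2 + c/r^2.\<close>
    define q where "q = c / r\<^sup>2"
    have c: "c = q * r\<^sup>2" using rc(1) by (simp add: q_def)
    \<comment> \<open>If q = 1, then c = r^2 and A = 0.\<close>
    have "q \<noteq> 1" using AB(1) rc(2) c by auto
    moreover have "- q \<noteq> s\<^sup>2" for s
    proof
      assume "- q = s\<^sup>2"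
      then have "q = - (s\<^sup>2)" by simp
      \<comment> \<open>The quartic would then split completely, with roots r, -r, sr and
        -sr.\<close>
      then have "c = - (s * r)\<^sup>2" by (simp add: c power_mult_distrib)
      then have "set [1, 1, 2 :: nat] \<subseteq> {1}"
        using red rc by (intro biquadratic_split_degrees[of "s * r" r]) simp
      then show False by simp
    qed
    moreover have "eq_up_to_scaling 4 2 (A, B) (q - 1, - q)"
      unfolding eq_up_to_scaling_def using rc c
      by (auto intro!: exI[of _ r] simp: algebra_simps power2_eq_square power4_eq_xxxx)
    ultimately show "\<exists>q. q \<noteq> 1 \<and> \<not> (\<exists>r. - q = r\<^sup>2) \<and> eq_up_to_scaling 4 2 (A, B) (q - 1, - q)"
      by blast
  next
    assume "\<exists>q. q \<noteq> 1 \<and> \<not> (\<exists>r. - q = r\<^sup>2) \<and> eq_up_to_scaling 4 2 (A, B) (q - 1, - q)"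
    then obtain q l where q: "\<And>r. - q \<noteq> r\<^sup>2" and l: "l \<noteq> 0" "A = (q - 1) * l\<^sup>2" "B = - q * l ^ 4"
      by (auto simp: eq_up_to_scaling_def)
    \<comment> \<open>Dividing by the nonzero square l^2 would make \<open>- q\<close> a
      square.\<close>
    have "- (q * l\<^sup>2) \<noteq> r\<^sup>2" for r
      using q[of "r / l"] l(1) by (auto simp: field_simps)
    then have "reducibility_type (trinomial 4 2 (q * l\<^sup>2 - l\<^sup>2) (- (q * l\<^sup>2) * l\<^sup>2)) [1, 1, 2]"
      by (intro reducibility_type_112I) auto
    moreover have "A = q * l\<^sup>2 - l\<^sup>2" "B = - (q * l\<^sup>2) * l\<^sup>2"
      using l by (simp_all add: algebra_simps power2_eq_square power4_eq_xxxx)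
    ultimately show "reducibility_type (trinomial 4 2 A B) [1, 1, 2]" by simp
  next
    assume red: "reducibility_type (trinomial 4 2 A B) [1, 1, 1, 1]"
    obtain r c where rc: "r \<noteq> 0" "A = c - r\<^sup>2" "B = - c * r\<^sup>2"
      using reducibility_type_linear_factor[OF red _ AB(2)] by auto
    have "2 \<notin> set [1, 1, 1, 1 :: nat]" by simp
    then obtain t where t: "- c = t\<^sup>2"
      using red reducibility_type_quadratic_factor unfolding rc by blast
    \<comment> \<open>The roots are r, -r, t and -t; scaling by \<open>r\<close> sends them to 1,
      -1, u and -u.\<close>
    define u where "u = t / r"
    have "t = u * r" using rc(1) by (simp add: u_def)
    then have c: "c = - (u\<^sup>2 * r\<^sup>2)"
      using t by (simp add: power_mult_distrib minus_equation_iff)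
    have "u \<noteq> 0" using AB(2) rc(3) c by auto
    moreover have "eq_up_to_scaling 4 2 (A, B) (- (u\<^sup>2) - 1, u\<^sup>2)"
      unfolding eq_up_to_scaling_def using rc c
      by (auto intro!: exI[of _ r] simp: algebra_simps power2_eq_square power4_eq_xxxx)
    ultimately show "\<exists>u. u \<noteq> 0 \<and> eq_up_to_scaling 4 2 (A, B) (- (u\<^sup>2) - 1, u\<^sup>2)"
      by blast
  next
    assume "\<exists>u. u \<noteq> 0 \<and> eq_up_to_scaling 4 2 (A, B) (- (u\<^sup>2) - 1, u\<^sup>2)"
    then obtain u l where "A = (- (u\<^sup>2) - 1) * l\<^sup>2" "B = u\<^sup>2 * l ^ 4"
      by (auto simp: eq_up_to_scaling_def)
    \<comment> \<open>Undoing the scaling gives the split quartic with roots l, -l, ul and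
      -ul.\<close>
    then have "A = - (u * l)\<^sup>2 - l\<^sup>2" "B = (u * l)\<^sup>2 * l\<^sup>2"
      by (simp_all add: algebra_simps power2_eq_square power4_eq_xxxx)
    then show "reducibility_type (trinomial 4 2 A B) [1, 1, 1, 1]"
      by (simp only: reducibility_type_1111I)
  next
    fix q :: rat
    show "trinomial 4 2 (q - 1) (- q) = [:- 1, 1:] * [:1, 1:] * [:q, 0, 1:]"
      using biquadratic_factor[of 1 q] by simp
  next
    fix u :: rat
    show "trinomial 4 2 (- (u\<^sup>2) - 1) (u\<^sup>2) = [:- 1, 1:] * [:1, 1:] * [:- u, 1:] * [:u, 1:]"
      using biquadratic_split[of 1 u] by simp
  }
qed

end
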